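(* Let $a,b,c,d$ be four distinct letters, $\Sigma=\{a,b,c,d\}$, let $f_{m,n}$ be the two-dimensional Fibonacci arrays defined in the context, and let $\mu$ be the map defined in the context. Then for all $m,n\ge1$, the image $\mu(f_{m,n})$ is defined and $\mu(f_{m,n})=f_{m+1,n+1}$.
   Context: For arrays $u,v$ with equal numbers of rows, $u\circ_c v$ places $v$ to the right of $u$; with equal numbers of columns, $u\circ_r v$ places $v$ below $u$. Two-dimensional Fibonacci arrays: $f_{0,0}=a$, $f_{0,1}=b$, $f_{1,0}=c$, $f_{1,1}=d$, and for $k\ge0$, $m,n\ge1$: $f_{k,n+1}=f_{k,n}\circ_c f_{k,n-1}$, $f_{m+1,k}=f_{m,k}\circ_r f_{m-1,k}$. The map $\mu$ assigns to each letter an array: $\mu(d)=\begin{smallmatrix} d & c\\ b & a\end{smallmatrix}$ (size $2\times2$), $\mu(c)=\begin{smallmatrix} d\\ b\end{smallmatrix}$ (size $2\times1$), $\mu(b)=\begin{smallmatrix} d & c\end{smallmatrix}$ (size $1\times2$), $\mu(a)=d$. For an array $x=[x_{i,j}]$ of size $(p,q)$ such that, for each row index $i$, all $\mu(x_{i,j})$ ($1\le j\le q$) have the same number of rows, and for each column index $j$, all $\mu(x_{i,j})$ ($1\le i\le p$) have the same number of columns, the image is $\mu(x)=R_1\circ_r R_2\circ_r\cdots\circ_r R_p$ where $R_i=\mu(x_{i,1})\circ_c\cdots\circ_c\mu(x_{i,q})$. *)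

theory Defs
  imports "Jordan_Normal_Form.Matrix"
begin

text \<open>
  Arrays over the alphabet are matrices with letters as entries (indices start at 0); two
  such matrices are equal iff they have the same size and the same entries.
\<close>

datatype letter = La | Lb | Lc | Ld

type_synonym array = "letter mat"

text \<open>
  The concatenations are written as total functions. They are meaningful only if the
  operands have equally many rows (for \<open>\<circ>\<^sub>c\<close>) or columns (for \<open>\<circ>\<^sub>r\<close>); outside this case
  the result has unspecified entries.
\<close>

definition col_cat :: "array \<Rightarrow> array \<Rightarrow> array" (infixl "\<circ>\<^sub>c" 65) where
  "u \<circ>\<^sub>c v = mat (dim_row u) (dim_col u + dim_col v)
     (\<lambda>(i, j). if j < dim_col u then u $$ (i, j) else v $$ (i, j - dim_col u))"

definition row_cat :: "array \<Rightarrow> array \<Rightarrow> array" (infixl "\<circ>\<^sub>r" 65) where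
  "u \<circ>\<^sub>r v = mat (dim_row u + dim_row v) (dim_col u)
     (\<lambda>(i, j). if i < dim_row u then u $$ (i, j) else v $$ (i - dim_row u, j))"

text \<open>
  The column recursion is used for every row index, the row recursion only for the column
  indices 0 and 1. That the row recursion then holds for every column index, and that all
  concatenations involved are well-defined, is shown in the lemmas below.
\<close>

fun fib_array :: "nat \<Rightarrow> nat \<Rightarrow> array" where
  "fib_array 0 0 = mat_of_rows_list 1 [[La]]"
| "fib_array 0 (Suc 0) = mat_of_rows_list 1 [[Lb]]"
| "fib_array (Suc 0) 0 = mat_of_rows_list 1 [[Lc]]"
| "fib_array (Suc 0) (Suc 0) = mat_of_rows_list 1 [[Ld]]"
| "fib_array (Suc (Suc m)) 0 = fib_array (Suc m) 0 \<circ>\<^sub>r fib_array m 0"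
| "fib_array (Suc (Suc m)) (Suc 0) = fib_array (Suc m) (Suc 0) \<circ>\<^sub>r fib_array m (Suc 0)"
| "fib_array k (Suc (Suc n)) = fib_array k (Suc n) \<circ>\<^sub>c fib_array k n"

lemma dim_col_cat [simp]:
  "dim_row (u \<circ>\<^sub>c v) = dim_row u" "dim_col (u \<circ>\<^sub>c v) = dim_col u + dim_col v"
  by (simp_all add: col_cat_def)

lemma dim_row_cat [simp]:
  "dim_row (u \<circ>\<^sub>r v) = dim_row u + dim_row v" "dim_col (u \<circ>\<^sub>r v) = dim_col u"
  by (simp_all add: row_cat_def)

lemma cat_interchange:
  assumes "dim_row u = dim_row v" "dim_row w = dim_row z" "dim_col u = dim_col w"
    "dim_col v = dim_col z"
  shows "(u \<circ>\<^sub>c v) \<circ>\<^sub>r (w \<circ>\<^sub>c z) = (u \<circ>\<^sub>r w) \<circ>\<^sub>c (v \<circ>\<^sub>r z)"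
  using assms by (intro eq_matI) (auto simp: row_cat_def col_cat_def)

lemma dim_mat_of_rows_list [simp]:
  "dim_row (mat_of_rows_list k rs) = length rs" "dim_col (mat_of_rows_list k rs) = k"
  by (simp_all add: mat_of_rows_list_def)

lemma dim_fib_array_base:
  "dim_row (fib_array m (Suc 0)) = dim_row (fib_array m 0) \<and>
   dim_col (fib_array m 0) = 1 \<and> dim_col (fib_array m (Suc 0)) = 1"
  by (induction m rule: induct_nat_012) auto

lemma dim_fib_array:
  "dim_row (fib_array m n) = dim_row (fib_array m 0) \<and>
   dim_col (fib_array m n) = dim_col (fib_array 0 n)"
  by (induction n rule: induct_nat_012) (auto simp: dim_fib_array_base)

lemma dim_row_fib_array: "dim_row (fib_array m n) = dim_row (fib_array m n')"
  by (metis dim_fib_array)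

lemma dim_col_fib_array: "dim_col (fib_array m n) = dim_col (fib_array m' n)"
  by (metis dim_fib_array)

lemma fib_array_col:
  assumes "n \<ge> 1"
  shows "fib_array k (n + 1) = fib_array k n \<circ>\<^sub>c fib_array k (n - 1)"
  using assms by (cases n) auto

lemma fib_array_row:
  assumes "m \<ge> 1"
  shows "fib_array (m + 1) k = fib_array m k \<circ>\<^sub>r fib_array (m - 1) k"
proof -
  obtain l where m: "m = Suc l"
    using assms by (cases m) auto
  have "fib_array (Suc (Suc l)) k = fib_array (Suc l) k \<circ>\<^sub>r fib_array l k"
  proof (induction k rule: induct_nat_012)
    case (ge2 n)
    then show ?case
      by (simp add: cat_interchange dim_row_fib_array[of _ "Suc n" n]
          dim_col_fib_array[of "Suc l" _ l])
  qed simp_all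
  then show ?thesis
    by (simp add: m)
qed

fun mu_letter :: "letter \<Rightarrow> array" where
  "mu_letter Ld = mat_of_rows_list 2 [[Ld, Lc], [Lb, La]]"
| "mu_letter Lc = mat_of_rows_list 1 [[Ld], [Lb]]"
| "mu_letter Lb = mat_of_rows_list 2 [[Ld, Lc]]"
| "mu_letter La = mat_of_rows_list 1 [[Ld]]"

definition mu_defined :: "array \<Rightarrow> bool" where
  "mu_defined x \<longleftrightarrow> dim_row x > 0 \<and> dim_col x > 0 \<and>
     (\<forall>i < dim_row x. \<forall>j < dim_col x. \<forall>j' < dim_col x.
        dim_row (mu_letter (x $$ (i, j))) = dim_row (mu_letter (x $$ (i, j')))) \<and>
     (\<forall>j < dim_col x. \<forall>i < dim_row x. \<forall>i' < dim_row x.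
        dim_col (mu_letter (x $$ (i, j))) = dim_col (mu_letter (x $$ (i', j))))"

definition mu_row :: "array \<Rightarrow> nat \<Rightarrow> array" where
  "mu_row x i = foldl (\<circ>\<^sub>c) (mu_letter (x $$ (i, 0)))
     (map (\<lambda>j. mu_letter (x $$ (i, j))) [1..<dim_col x])"

text \<open>The value \<open>None\<close> means that the image is not defined.\<close>

definition mu :: "array \<Rightarrow> array option" where
  "mu x = (if mu_defined x
           then Some (foldl (\<circ>\<^sub>r) (mu_row x 0) (map (mu_row x) [1..<dim_row x]))
           else None)"

end

theory Submission
  imports Defs
begin

text \<open>
  A letter is a pair of bits, one telling whether its image under \<open>\<mu>\<close> has two rows and the
  other whether it has two columns. In these terms the array \<open>f\<^sub>m\<^sub>,\<^sub>n\<close> is the product of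
  the one-dimensional Fibonacci words of indices \<open>m\<close> and \<open>n\<close>, and \<open>\<mu>\<close> acts on a product by
  applying the Fibonacci morphism to both factors; this morphism maps each Fibonacci word to
  the next one.
\<close>

text \<open>The bits are the indices of the base array made of that letter: \<open>Lb\<close> is
  \<open>fib_array 0 1\<close>, hence \<open>False True\<close>.\<close>

fun letter_of_bits :: "bool \<Rightarrow> bool \<Rightarrow> letter" where
  "letter_of_bits False False = La"
| "letter_of_bits False True = Lb"
| "letter_of_bits True False = Lc"
| "letter_of_bits True True = Ld"

definition word_product :: "bool list \<Rightarrow> bool list \<Rightarrow> array" where
  "word_product u v =
     mat (length u) (length v) (\<lambda>(i, j). letter_of_bits (u ! i) (v ! j))"

lemma dim_word_product [simp]:
  "dim_row (word_product u v) = length u" "dim_col (word_product u v) = length v"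
  by (simp_all add: word_product_def)

lemma index_word_product [simp]:
  "i < length u \<Longrightarrow> j < length v \<Longrightarrow> word_product u v $$ (i, j) = letter_of_bits (u ! i) (v ! j)"
  by (simp add: word_product_def)

lemma word_product_col_cat: "word_product u v \<circ>\<^sub>c word_product u w = word_product u (v @ w)"
  by (intro eq_matI) (auto simp: col_cat_def nth_append)

lemma word_product_row_cat: "word_product u w \<circ>\<^sub>r word_product v w = word_product (u @ v) w"
  by (intro eq_matI) (auto simp: row_cat_def nth_append)

fun fib_word :: "nat \<Rightarrow> bool list" where
  "fib_word 0 = [False]"
| "fib_word (Suc 0) = [True]"
| "fib_word (Suc (Suc n)) = fib_word (Suc n) @ fib_word n"

lemma fib_word_neq_Nil: "fib_word n \<noteq> []"
  by (induction n rule: fib_word.induct) auto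

text \<open>The base arrays are products of one-letter words, and each concatenation in the
  recursion extends one factor by the Fibonacci word rule.\<close>

lemma fib_array_eq_word_product: "fib_array m n = word_product (fib_word m) (fib_word n)"
  by (induction m n rule: fib_array.induct)
    (auto simp: word_product_col_cat word_product_row_cat mat_of_rows_list_def
      intro!: eq_matI)

fun fib_morphism :: "bool \<Rightarrow> bool list" where
  "fib_morphism False = [True]"
| "fib_morphism True = [True, False]"

text \<open>A morphism respects \<open>@\<close>, so both sides obey the same recursion and only the
  two base words need checking.\<close>

lemma fib_morphism_fib_word: "concat (map fib_morphism (fib_word n)) = fib_word (Suc n)"
  by (induction n rule: fib_word.induct) auto

lemma mu_letter_of_bits:
  "mu_letter (letter_of_bits p q) = word_product (fib_morphism p) (fib_morphism q)"
  by (cases p; cases q)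
    (auto simp: mat_of_rows_list_def less_Suc_eq numeral_2_eq_2 intro!: eq_matI)

lemma foldl_col_cat_word_product:
  "foldl (\<circ>\<^sub>c) (word_product u v) (map (word_product u) vs) = word_product u (v @ concat vs)"
  by (induction vs arbitrary: v) (simp_all add: word_product_col_cat)

lemma foldl_row_cat_word_product:
  "foldl (\<circ>\<^sub>r) (word_product u v) (map (\<lambda>w. word_product w v) us)
     = word_product (u @ concat us) v"
  by (induction us arbitrary: u) (simp_all add: word_product_row_cat)

text \<open>The folds in \<open>mu_row\<close> and \<open>mu\<close> start from index 0 and then run
  over the indices from 1; this turns that run into a map over the tail of a word.\<close>

lemma map_nth_Cons_upt: "map (\<lambda>i. f ((x # xs) ! i)) [1..<Suc (length xs)] = map f xs"
  by (intro nth_equalityI) (auto simp del: upt_Suc)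

lemma mu_row_word_product:
  assumes "i < length u" and "v \<noteq> []"
  shows "mu_row (word_product u v) i =
    word_product (fib_morphism (u ! i)) (concat (map fib_morphism v))"
proof -
  obtain q w where v: "v = q # w"
    using assms(2) by (cases v) auto
  have "map (\<lambda>j. mu_letter (word_product u v $$ (i, j))) [1..<dim_col (word_product u v)]
      = map (\<lambda>j. word_product (fib_morphism (u ! i)) (fib_morphism (v ! j))) [1..<length v]"
    using assms(1) by (auto simp: mu_letter_of_bits)
  \<comment> \<open>All images in row \<open>i\<close> share the left factor
    \<open>fib_morphism (u ! i)\<close>, so joining them only concatenates right factors.\<close>
  also have "\<dots> = map (word_product (fib_morphism (u ! i))) (map fib_morphism w)"
    unfolding v
    using map_nth_Cons_upt[of "\<lambda>r. word_product (fib_morphism (u ! i)) (fib_morphism r)" q w]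
    by (simp add: comp_def del: upt_Suc)
  finally show ?thesis
    using assms(1) unfolding mu_row_def
    by (simp add: v mu_letter_of_bits foldl_col_cat_word_product del: map_map upt_Suc)
qed

lemma mu_word_product:
  assumes "u \<noteq> []" and "v \<noteq> []"
  shows "mu (word_product u v) =
    Some (word_product (concat (map fib_morphism u)) (concat (map fib_morphism v)))"
proof -
  let ?v = "concat (map fib_morphism v)"
  obtain p t where u: "u = p # t"
    using assms(1) by (cases u) auto
  \<comment> \<open>The height of the image of entry \<open>(i, j)\<close> depends only on
    \<open>u ! i\<close>, its width only on \<open>v ! j\<close>.\<close>
  have defined: "mu_defined (word_product u v)"
    using assms by (simp add: mu_defined_def mu_letter_of_bits)
  have "map (mu_row (word_product u v)) [1..<dim_row (word_product u v)]
      = map (\<lambda>i. word_product (fib_morphism (u ! i)) ?v) [1..<length u]"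
    using assms(2) by (auto simp: mu_row_word_product)
  \<comment> \<open>Dually, all rows share the right factor \<open>?v\<close>, so stacking them
    concatenates left factors.\<close>
  also have "\<dots> = map (\<lambda>w. word_product w ?v) (map fib_morphism t)"
    unfolding u using map_nth_Cons_upt[of "\<lambda>r. word_product (fib_morphism r) ?v" p t]
    by (simp add: comp_def del: upt_Suc)
  finally show ?thesis
    using assms(2) defined unfolding mu_def
    by (simp add: u mu_row_word_product foldl_row_cat_word_product del: map_map upt_Suc)
qed

theorem theorem12:
  fixes m n :: nat
  assumes "m \<ge> 1" and "n \<ge> 1"
  shows "mu (fib_array m n) = Some (fib_array (m + 1) (n + 1))"
  by (simp add: fib_array_eq_word_product mu_word_product fib_word_neq_Nil
      fib_morphism_fib_word)

end
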